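(* (a) An even-dimensional associated magic square matrix, of any weight (zero or non-zero), never has full rank, and has neither a left nor a right quasi-inverse. (b) Let $n\in\mathbb{N}$. There exist $(2n+1)\times(2n+1)$ associated magic square matrices of non-zero weight which have full rank. The maximal rank of a $(2n+1)\times(2n+1)$ associated magic square matrix of weight $0$ is $2n$, and every such weight $0$ matrix of rank $2n$ has both a left and a right quasi-inverse.
   Context: An $m\times m$ real matrix $M$ is a semimagic square of weight $w\in\mathbb{R}$ if each of its rows and columns sums to $mw$; it is magic (a magic square) if, in addition, each of its two diagonals sums to $mw$. A semimagic square of weight $w$ is associated if $M_{ij}+M_{m+1-i,m+1-j}=2w$ for all $i,j\in\{1,\dots,m\}$ (it is then automatically magic). Let $\mathcal{I}_m$ be the $m\times m$ unit matrix, $\mathcal{E}_m$ the $m\times m$ matrix with all entries $1$, and $\mathcal{U}_m:=\mathcal{I}_m-\frac1m\mathcal{E}_m$. A left (right) quasi-inverse of an $m\times m$ matrix $M$ is a real $m\times m$ matrix $Q$ such that $QM=\mathcal{U}_m$ (respectively $MQ=\mathcal{U}_m$). *)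

theory Defs
  imports Complex_Main "Jordan_Normal_Form.DL_Rank"
begin

text \<open>
  Entries of an \<open>m \<times> m\<close> matrix are indexed by \<open>0, \<dots>, m - 1\<close> instead of \<open>1, \<dots>, m\<close>,
  so the index reflection \<open>i \<mapsto> m + 1 - i\<close> becomes \<open>i \<mapsto> m - 1 - i\<close>.
\<close>

definition semimagic :: "nat \<Rightarrow> real \<Rightarrow> real mat \<Rightarrow> bool" where
  "semimagic m w M \<longleftrightarrow> M \<in> carrier_mat m m \<and>
     (\<forall>i<m. (\<Sum>j<m. M $$ (i, j)) = real m * w) \<and>
     (\<forall>j<m. (\<Sum>i<m. M $$ (i, j)) = real m * w)"

definition magic :: "nat \<Rightarrow> real \<Rightarrow> real mat \<Rightarrow> bool" where
  "magic m w M \<longleftrightarrow> semimagic m w M \<and>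
     (\<Sum>i<m. M $$ (i, i)) = real m * w \<and>
     (\<Sum>i<m. M $$ (i, m - 1 - i)) = real m * w"

definition associated :: "nat \<Rightarrow> real \<Rightarrow> real mat \<Rightarrow> bool" where
  "associated m w M \<longleftrightarrow> semimagic m w M \<and>
     (\<forall>i<m. \<forall>j<m. M $$ (i, j) + M $$ (m - 1 - i, m - 1 - j) = 2 * w)"

lemma associated_imp_magic:
  assumes "associated m w M"
  shows "magic m w M"
proof -
  have reindex: "(\<Sum>i<m. f (m - 1 - i)) = (\<Sum>i<m. f i)" for f :: "nat \<Rightarrow> real"
    using sum.nat_diff_reindex[of f m] by simp
  have "(\<Sum>i<m. M $$ (i, i)) + (\<Sum>i<m. M $$ (m - 1 - i, m - 1 - i)) = (\<Sum>i<m. 2 * w)"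
    unfolding sum.distrib[symmetric] using assms by (intro sum.cong) (auto simp: associated_def)
  then have diag: "(\<Sum>i<m. M $$ (i, i)) = real m * w"
    using reindex[of "\<lambda>i. M $$ (i, i)"] by simp
  have "(\<Sum>i<m. M $$ (i, m - 1 - i)) + (\<Sum>i<m. M $$ (m - 1 - i, m - 1 - (m - 1 - i)))
      = (\<Sum>i<m. 2 * w)"
    unfolding sum.distrib[symmetric]
  proof (rule sum.cong[OF refl])
    fix i assume "i \<in> {..<m}"
    then have "i < m" "m - 1 - i < m" by auto
    then show "M $$ (i, m - 1 - i) + M $$ (m - 1 - i, m - 1 - (m - 1 - i)) = 2 * w"
      using assms unfolding associated_def by blast
  qed
  then have "(\<Sum>i<m. M $$ (i, m - 1 - i)) = real m * w"
    using reindex[of "\<lambda>i. M $$ (i, m - 1 - i)"] by simp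
  with diag assms show ?thesis
    by (simp add: magic_def associated_def)
qed

abbreviation mat_rank :: "nat \<Rightarrow> real mat \<Rightarrow> nat" where
  "mat_rank m M \<equiv> vec_space.rank m M"

definition ones_mat :: "nat \<Rightarrow> real mat" where
  "ones_mat m = mat m m (\<lambda>_. 1)"

definition U_mat :: "nat \<Rightarrow> real mat" where
  "U_mat m = 1\<^sub>m m - (1 / real m) \<cdot>\<^sub>m ones_mat m"

definition left_quasi_inverse :: "nat \<Rightarrow> real mat \<Rightarrow> real mat \<Rightarrow> bool" where
  "left_quasi_inverse m M Q \<longleftrightarrow> Q \<in> carrier_mat m m \<and> Q * M = U_mat m"

definition right_quasi_inverse :: "nat \<Rightarrow> real mat \<Rightarrow> real mat \<Rightarrow> bool" where
  "right_quasi_inverse m M Q \<longleftrightarrow> Q \<in> carrier_mat m m \<and> M * Q = U_mat m"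

end

theory Submission
  imports Defs
begin

text \<open>
  Write \<open>e\<close> for the all-ones vector and \<open>E\<close> for the all-ones matrix.

  In even dimension \<open>m = 2 k\<close> the reflection \<open>i \<mapsto> m - 1 - i\<close> has no fixed point, so the
  antisymmetric vectors \<open>v\<close> (those with \<open>v\<^sub>i + v\<^bsub>m-1-i\<^esub> = 0\<close>) form a space of dimension \<open>k\<close>.
  An associated matrix sends it into the symmetric vectors with coordinate sum \<open>0\<close>, a space of
  dimension only \<open>k - 1\<close>. Hence some nonzero antisymmetric \<open>v\<close> is annihilated
  (\<open>associated_even_kernel_sum_zero\<close>). This excludes full rank; it also excludes \<open>Q M = U\<close>,
  since \<open>U\<close> fixes every vector with coordinate sum \<open>0\<close>. Transposition handles right
  quasi-inverses.

  In odd dimension \<open>m\<close>, a weight \<open>0\<close> matrix \<open>N\<close> annihilates \<open>e\<close>, so its rank is at most \<open>m - 1\<close>.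
  Everything else follows from the observation that \<open>N + w E\<close>, for \<open>w \<noteq> 0\<close>, is nonsingular as soon
  as \<open>e\<close> spans the kernel of \<open>N\<close> (\<open>det_add_ones_nonzero\<close>): \<open>w E\<close> acts invertibly on the line of \<open>e\<close>
  and vanishes on the complementary space of vectors with coordinate sum \<open>0\<close>, which \<open>N\<close> preserves.
  The inverse of \<open>N + E\<close> is then a two-sided quasi-inverse of \<open>N\<close>, and the rank of \<open>N\<close> is at least
  \<open>m - 1\<close> because \<open>E\<close> has rank \<open>1\<close>. The difference of the cyclic shift and its inverse is an
  associated matrix of weight \<open>0\<close> to which this applies: its kernel consists of the \<open>v\<close> that are
  invariant under a cyclic shift by \<open>2\<close>, and for odd \<open>m\<close> these are the constant vectors.
\<close>

section \<open>Kernels and rank\<close>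

lemma index_mult_mat_vec_sum:
  fixes A :: "real mat"
  assumes "A \<in> carrier_mat n m" "v \<in> carrier_vec m" "i < n"
  shows "(A *\<^sub>v v) $ i = (\<Sum>j<m. A $$ (i, j) * v $ j)"
  using assms by (auto simp: scalar_prod_def atLeast0LessThan intro!: sum.cong)

lemma index_mult_mat_sum:
  fixes A :: "real mat"
  assumes "A \<in> carrier_mat n l" "B \<in> carrier_mat l m" "i < n" "j < m"
  shows "(A * B) $$ (i, j) = (\<Sum>k<l. A $$ (i, k) * B $$ (k, j))"
  using assms by (auto simp: scalar_prod_def atLeast0LessThan intro!: sum.cong)

text \<open>
  A square matrix whose rank drops by at most one has a kernel of dimension at most one. The
  form stated here exhibits a coordinate on which the kernel projects injectively: all columns
  except possibly the \<open>k\<close>-th are linearly independent.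
\<close>

lemma (in vec_space) kernel_determined_by_coordinate:
  assumes A: "A \<in> carrier_mat n n" and rank: "n \<le> Suc (rank A)" and "0 < n"
  obtains k where "k < n"
    "\<And>z. z \<in> carrier_vec n \<Longrightarrow> A *\<^sub>v z = 0\<^sub>v n \<Longrightarrow> z $ k = 0 \<Longrightarrow> z = 0\<^sub>v n"
proof -
  obtain S where S: "maximal S (\<lambda>T. T \<subseteq> set (cols A) \<and> lin_indpt T)"
    using maximal_exists[of "(\<lambda>T. T \<subseteq> set (cols A) \<and> lin_indpt T)" "card (set (cols A))" "{}"]
    by (meson List.finite_set card_mono empty_iff empty_subsetI finite_lin_indpt2 rev_finite_subset)
  then have sub: "S \<subseteq> set (cols A)" and indpt: "lin_indpt S"
    by (auto simp: maximal_def)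
  have finS: "finite S"
    using sub by (rule finite_subset) simp
  have S_carrier: "S \<subseteq> carrier_vec n"
    using sub cols_dim[of A] A by auto
  have "\<exists>j<n. col A j = s" if "s \<in> S" for s
    using that sub A by (metis carrier_matD(2) cols_length cols_nth in_set_conv_nth subsetD)
  then obtain g where g: "\<And>s. s \<in> S \<Longrightarrow> g s < n" "\<And>s. s \<in> S \<Longrightarrow> col A (g s) = s"
    by metis
  have inj: "inj_on g S"
    using g(2) by (metis inj_onI)
  define J where "J = g ` S"
  have J: "J \<subseteq> {..<n}" "finite J" "card J = rank A"
    using g(1) finS rank_card_indpt[OF A S] card_image[OF inj] by (auto simp: J_def)
  \<comment> \<open>the independent columns \<open>S\<close> occupy distinct positions, so they leave out at most one index\<close>
  have "card ({..<n} - J) \<le> Suc 0"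
    using rank J by (simp add: card_Diff_subset)
  then have unique: "\<forall>a\<in>{..<n} - J. \<forall>b\<in>{..<n} - J. a = b"
    by (subst (asm) card_le_Suc0_iff_eq) simp_all
  have "\<exists>k<n. {..<n} - J \<subseteq> {k}"
  proof (cases "{..<n} - J = {}")
    case True
    then show ?thesis using \<open>0 < n\<close> by blast
  next
    case False
    then obtain k where "k \<in> {..<n} - J" by blast
    with unique have "k < n" "{..<n} - J \<subseteq> {k}" by auto
    then show ?thesis by blast
  qed
  then obtain k where k: "k < n" "{..<n} - J \<subseteq> {k}"
    by blast
  show ?thesis
  proof (rule that[OF k(1)])
    fix z assume z: "z \<in> carrier_vec n" "A *\<^sub>v z = 0\<^sub>v n" "z $ k = 0"
    have "lincomb (\<lambda>s. z $ g s) S = 0\<^sub>v n"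
    proof (rule eq_vecI)
      fix i assume "i < dim_vec (0\<^sub>v n :: 'a vec)"
      then have i: "i < n" by simp
      have "lincomb (\<lambda>s. z $ g s) S $ i = (\<Sum>s\<in>S. z $ g s * s $ i)"
        by (rule lincomb_index[OF i S_carrier])
      also have "\<dots> = (\<Sum>s\<in>S. A $$ (i, g s) * z $ g s)"
      proof (rule sum.cong[OF refl])
        fix s assume s: "s \<in> S"
        have "col A (g s) $ i = A $$ (i, g s)"
          using A i g(1)[OF s] by simp
        then show "z $ g s * s $ i = A $$ (i, g s) * z $ g s"
          using g(2)[OF s] by simp
      qed
      also have "\<dots> = (\<Sum>j\<in>J. A $$ (i, j) * z $ j)"
        unfolding J_def by (simp add: sum.reindex[OF inj])
      also have "\<dots> = (\<Sum>j<n. A $$ (i, j) * z $ j)"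
        using J(1) k(2) z(3) by (intro sum.mono_neutral_left) auto
      also have "\<dots> = (A *\<^sub>v z) $ i"
        using A z(1) i by (auto simp: scalar_prod_def atLeast0LessThan intro!: sum.cong)
      finally show "lincomb (\<lambda>s. z $ g s) S $ i = 0\<^sub>v n $ i"
        by (simp add: z(2))
    qed (use lincomb_dim[OF finS S_carrier] in simp)
    then have zero: "z $ g s = 0" if "s \<in> S" for s
      using not_lindepD[OF indpt finS subset_refl, of "\<lambda>s. z $ g s"] that by auto
    show "z = 0\<^sub>v n"
    proof (rule eq_vecI)
      fix i assume "i < dim_vec (0\<^sub>v n :: 'a vec)"
      then have "i = k \<or> i \<in> J" using k(2) by auto
      then show "z $ i = 0\<^sub>v n $ i"
        using z(3) zero k(1) J(1) by (auto simp: J_def)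
    qed (use z(1) in simp)
  qed
qed

section \<open>Adding a constant to a semimagic square of weight zero\<close>

lemma ones_mat_carrier [simp]: "ones_mat m \<in> carrier_mat m m"
  by (simp add: ones_mat_def)

lemma one_smult_ones_mat: "1 \<cdot>\<^sub>m ones_mat m = ones_mat m"
  by (rule eq_matI) auto

lemma U_mat_carrier [simp]: "U_mat m \<in> carrier_mat m m"
  unfolding U_mat_def by (intro minus_carrier_mat smult_carrier_mat ones_mat_carrier)

lemma semimagic_carrier: "semimagic m w M \<Longrightarrow> M \<in> carrier_mat m m"
  by (simp add: semimagic_def)

lemma semimagic_mult_ones:
  assumes "semimagic m w M"
  shows "M * ones_mat m = (real m * w) \<cdot>\<^sub>m ones_mat m"
    and "ones_mat m * M = (real m * w) \<cdot>\<^sub>m ones_mat m"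
proof -
  have M: "M \<in> carrier_mat m m"
    using assms by (rule semimagic_carrier)
  show "M * ones_mat m = (real m * w) \<cdot>\<^sub>m ones_mat m"
  proof (rule eq_matI)
    fix i j assume "i < dim_row ((real m * w) \<cdot>\<^sub>m ones_mat m)" "j < dim_col ((real m * w) \<cdot>\<^sub>m ones_mat m)"
    then show "(M * ones_mat m) $$ (i, j) = ((real m * w) \<cdot>\<^sub>m ones_mat m) $$ (i, j)"
      using assms index_mult_mat_sum[OF M ones_mat_carrier, of i j]
      by (simp add: ones_mat_def semimagic_def)
  qed (use M in \<open>simp_all add: ones_mat_def\<close>)
  show "ones_mat m * M = (real m * w) \<cdot>\<^sub>m ones_mat m"
  proof (rule eq_matI)
    fix i j assume "i < dim_row ((real m * w) \<cdot>\<^sub>m ones_mat m)" "j < dim_col ((real m * w) \<cdot>\<^sub>m ones_mat m)"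
    then show "(ones_mat m * M) $$ (i, j) = ((real m * w) \<cdot>\<^sub>m ones_mat m) $$ (i, j)"
      using assms index_mult_mat_sum[OF ones_mat_carrier M, of i j]
      by (simp add: ones_mat_def semimagic_def)
  qed (use M in \<open>simp_all add: ones_mat_def\<close>)
qed

lemma semimagic_add_ones:
  assumes "semimagic m 0 N"
  shows "semimagic m w (N + w \<cdot>\<^sub>m ones_mat m)"
  using assms by (auto simp: semimagic_def ones_mat_def sum.distrib)

lemma associated_add_ones:
  assumes "associated m 0 N"
  shows "associated m w (N + w \<cdot>\<^sub>m ones_mat m)"
proof -
  have N: "semimagic m 0 N" "N \<in> carrier_mat m m"
    and reflect: "\<And>i j. i < m \<Longrightarrow> j < m \<Longrightarrow> N $$ (i, j) + N $$ (m - 1 - i, m - 1 - j) = 0"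
    using assms by (auto simp: associated_def semimagic_def)
  have "(N + w \<cdot>\<^sub>m ones_mat m) $$ (i, j) = N $$ (i, j) + w" if "i < m" "j < m" for i j
    using N(2) that by (simp add: ones_mat_def)
  moreover have "m - 1 - i < m" if "i < m" for i
    using that by linarith
  ultimately show ?thesis
    using semimagic_add_ones[OF N(1)] reflect by (simp add: associated_def)
qed

lemma rank_ones_mat_le_1: "mat_rank m (ones_mat m) \<le> 1"
  by (rule vec_space.rank_le_1_product_entries[where f = "\<lambda>_. 1" and g = "\<lambda>_. 1", OF ones_mat_carrier])
    (simp add: ones_mat_def)

text \<open>
  Multiplying \<open>(N + w E) v = 0\<close> by \<open>E\<close> from the left kills \<open>N\<close> and shows that \<open>v\<close> has coordinate
  sum \<open>0\<close>. Then \<open>N v = 0\<close> as well, so \<open>v\<close> is constant, hence zero.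
\<close>

lemma det_add_ones_nonzero:
  assumes N: "semimagic m 0 N" and "w \<noteq> 0"
    and kernel: "\<And>v. v \<in> carrier_vec m \<Longrightarrow> N *\<^sub>v v = 0\<^sub>v m \<Longrightarrow> \<exists>c. v = vec m (\<lambda>_. c)"
  shows "det (N + w \<cdot>\<^sub>m ones_mat m) \<noteq> 0"
proof
  define A where "A = N + w \<cdot>\<^sub>m ones_mat m"
  have Nc: "N \<in> carrier_mat m m" and Ac: "A \<in> carrier_mat m m"
    using semimagic_carrier[OF N] by (auto simp: A_def)
  assume "det (N + w \<cdot>\<^sub>m ones_mat m) = 0"
  then obtain v where v: "v \<in> carrier_vec m" "v \<noteq> 0\<^sub>v m" "A *\<^sub>v v = 0\<^sub>v m"
    using det_0_iff_vec_prod_zero_field[OF Ac] by (auto simp: A_def)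
  have m: "0 < m"
    using v(1,2) by (cases m) auto
  have A_row: "(A *\<^sub>v v) $ i = (N *\<^sub>v v) $ i + w * (\<Sum>j<m. v $ j)" if "i < m" for i
    unfolding index_mult_mat_vec_sum[OF Ac v(1) that] index_mult_mat_vec_sum[OF Nc v(1) that]
    using that Nc by (simp add: A_def ones_mat_def algebra_simps sum.distrib sum_distrib_left)
  have "(ones_mat m * A) *\<^sub>v v = 0\<^sub>v m"
    unfolding assoc_mult_mat_vec[OF ones_mat_carrier Ac v(1)] v(3) by (auto simp: ones_mat_def)
  then have "((real m * w) \<cdot>\<^sub>m ones_mat m *\<^sub>v v) $ 0 = 0"
    using semimagic_mult_ones(2)[OF semimagic_add_ones[OF N, of w]] m by (simp add: A_def)
  moreover have "((real m * w) \<cdot>\<^sub>m ones_mat m *\<^sub>v v) $ 0 = (\<Sum>j<m. (real m * w) * v $ j)"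
    using m by (subst index_mult_mat_vec_sum[of _ m m]) (auto simp: ones_mat_def v(1))
  ultimately have sum_v: "(\<Sum>j<m. v $ j) = 0"
    using m \<open>w \<noteq> 0\<close> by (simp add: sum_distrib_left[symmetric])
  have "N *\<^sub>v v = 0\<^sub>v m"
    using A_row v(3) sum_v Nc by (intro eq_vecI) auto
  then obtain c where c: "v = vec m (\<lambda>_. c)"
    using kernel v(1) by blast
  then have "c = 0"
    using sum_v m by simp
  then show False
    using c v(2) by auto
qed

lemma semimagic_mult_ones_vec:
  assumes "semimagic m 0 N"
  shows "N *\<^sub>v vec m (\<lambda>_. c) = 0\<^sub>v m"
proof (rule eq_vecI)
  have N: "N \<in> carrier_mat m m"
    using assms by (rule semimagic_carrier)
  fix i assume "i < dim_vec (0\<^sub>v m :: real vec)"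
  then show "(N *\<^sub>v vec m (\<lambda>_. c)) $ i = 0\<^sub>v m $ i"
    using assms index_mult_mat_vec_sum[OF N, of "vec m (\<lambda>_. c)" i]
    by (simp add: semimagic_def sum_distrib_right[symmetric])
qed (use semimagic_carrier[OF assms] in simp)

lemma semimagic_zero_rank_less:
  assumes "semimagic m 0 N" "0 < m"
  shows "mat_rank m N < m"
proof -
  have "vec m (\<lambda>_. 1::real) \<noteq> 0\<^sub>v m"
    using assms(2) by (metis index_vec index_zero_vec(1) zero_neq_one)
  then have "det N = 0"
    using det_0_iff_vec_prod_zero_field[OF semimagic_carrier[OF assms(1)]]
      semimagic_mult_ones_vec[OF assms(1), of 1] by (metis vec_carrier)
  then show ?thesis
    by (rule vec_space.det_zero_low_rank[OF semimagic_carrier[OF assms(1)]])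
qed

text \<open>
  The all-ones vector lies in the kernel and has no vanishing coordinate, so subtracting a multiple
  of it makes the decisive coordinate of any other kernel vector vanish.
\<close>

lemma semimagic_kernel_constant:
  assumes N: "semimagic m 0 N" and rank: "m \<le> Suc (mat_rank m N)"
    and v: "v \<in> carrier_vec m" "N *\<^sub>v v = 0\<^sub>v m"
  shows "\<exists>c. v = vec m (\<lambda>_. c)"
proof (cases "m = 0")
  case True
  then have "v = vec m (\<lambda>_. 0)"
    using v(1) by (intro eq_vecI) auto
  then show ?thesis ..
next
  case False
  have Nc: "N \<in> carrier_mat m m"
    using N by (rule semimagic_carrier)
  obtain k where k: "k < m"
    "\<And>z. z \<in> carrier_vec m \<Longrightarrow> N *\<^sub>v z = 0\<^sub>v m \<Longrightarrow> z $ k = 0 \<Longrightarrow> z = 0\<^sub>v m"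
    using vec_space.kernel_determined_by_coordinate[OF Nc rank] False by blast
  define z where "z = v - vec m (\<lambda>_. v $ k)"
  have "N *\<^sub>v z = 0\<^sub>v m"
    using mult_minus_distrib_mat_vec[OF Nc v(1), of "vec m (\<lambda>_. v $ k)"]
    by (simp add: z_def v(2) semimagic_mult_ones_vec[OF N])
  then have "z = 0\<^sub>v m"
    using k v(1) by (auto simp: z_def)
  then have "v = vec m (\<lambda>_. v $ k)"
    using v(1) unfolding z_def by (auto simp: vec_eq_iff)
  then show ?thesis ..
qed

text \<open>
  Let \<open>Q\<close> be the inverse of \<open>A = N + E\<close>. Since \<open>A E = m E = E A\<close>, also \<open>Q E = E / m = E Q\<close>, and
  \<open>Q N = Q A - Q E = I - E / m\<close>; likewise on the other side.
\<close>

lemma semimagic_quasi_inverses: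
  assumes N: "semimagic m 0 N" and rank: "m \<le> Suc (mat_rank m N)"
  shows "\<exists>Q. left_quasi_inverse m N Q" and "\<exists>Q. right_quasi_inverse m N Q"
proof -
  define E where "E = ones_mat m"
  define A where "A = N + E"
  have carrier: "N \<in> carrier_mat m m" "E \<in> carrier_mat m m" "A \<in> carrier_mat m m"
    using semimagic_carrier[OF N] by (auto simp: A_def E_def)
  have A: "A = N + 1 \<cdot>\<^sub>m ones_mat m"
    by (simp add: A_def E_def one_smult_ones_mat)
  have "det A \<noteq> 0"
    unfolding A by (rule det_add_ones_nonzero[OF N]) (auto intro: semimagic_kernel_constant[OF N rank])
  then obtain Q where Q: "Q \<in> carrier_mat m m" "A * Q = 1\<^sub>m m" "Q * A = 1\<^sub>m m"
    using det_non_zero_imp_unit[OF carrier(3), of "()"] by (auto simp: Units_def ring_mat_def)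
  have AE: "A * E = real m \<cdot>\<^sub>m E" and EA: "E * A = real m \<cdot>\<^sub>m E"
    using semimagic_mult_ones[OF semimagic_add_ones[OF N, of 1]] by (simp_all add: A E_def)
  have U: "U_mat m = 1\<^sub>m m - (1 / real m) \<cdot>\<^sub>m E"
    by (simp add: U_mat_def E_def)
  have "E = Q * A * E"
    using Q carrier by simp
  also have "\<dots> = real m \<cdot>\<^sub>m (Q * E)"
    unfolding assoc_mult_mat[OF Q(1) carrier(3,2)] AE by (rule mult_smult_distrib[OF Q(1) carrier(2)])
  finally have "(1 / real m) \<cdot>\<^sub>m E = (1 / real m) \<cdot>\<^sub>m (real m \<cdot>\<^sub>m (Q * E))"
    by simp
  then have QE: "(1 / real m) \<cdot>\<^sub>m E = Q * E"
    using Q carrier by (cases "m = 0") auto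
  have "E = E * A * Q"
    using Q carrier by (simp add: assoc_mult_mat[OF carrier(2) carrier(3) Q(1)])
  also have "\<dots> = real m \<cdot>\<^sub>m (E * Q)"
    unfolding EA by (rule mult_smult_assoc_mat[OF carrier(2) Q(1)])
  finally have "(1 / real m) \<cdot>\<^sub>m E = (1 / real m) \<cdot>\<^sub>m (real m \<cdot>\<^sub>m (E * Q))"
    by simp
  then have EQ: "(1 / real m) \<cdot>\<^sub>m E = E * Q"
    using Q carrier by (cases "m = 0") auto
  have N_diff: "N = A - E"
    using carrier by (auto simp: A_def)
  have "Q * N = U_mat m"
    unfolding N_diff U QE using Q carrier by (simp add: mult_minus_distrib_mat[OF Q(1) carrier(3,2)])
  moreover have "N * Q = U_mat m"
    unfolding N_diff U EQ using Q carrier by (simp add: minus_mult_distrib_mat[OF carrier(3,2) Q(1)])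
  ultimately show "\<exists>Q. left_quasi_inverse m N Q" "\<exists>Q. right_quasi_inverse m N Q"
    using Q(1) by (auto simp: left_quasi_inverse_def right_quasi_inverse_def)
qed

section \<open>Even dimension\<close>

lemma sum_reflect_halves:
  fixes f :: "nat \<Rightarrow> real"
  shows "(\<Sum>j<2 * k. f j) = (\<Sum>j<k. f j + f (2 * k - 1 - j))"
proof -
  have "(\<Sum>j<2 * k. f j) = (\<Sum>j<k. f j) + (\<Sum>j\<in>{k..<2 * k}. f j)"
    by (subst sum.union_disjoint[symmetric]) (auto intro!: sum.cong)
  also have "(\<Sum>j\<in>{k..<2 * k}. f j) = (\<Sum>j<k. f (2 * k - 1 - j))"
    by (rule sum.reindex_bij_witness[of _ "\<lambda>j. 2 * k - 1 - j" "\<lambda>j. 2 * k - 1 - j"]) auto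
  finally show ?thesis
    by (simp add: sum.distrib)
qed

text \<open>
  In the coordinates given by the upper half of an antisymmetric vector and the upper half of its
  image, \<open>M\<close> acts as the \<open>k \<times> k\<close> matrix \<open>B\<close> below. By the associated property each column of \<open>B\<close>
  sums to a column sum of \<open>M\<close> minus \<open>2 k w\<close>, that is, to \<open>0\<close>; so \<open>B\<close> is singular.
\<close>

lemma associated_even_kernel_sum_zero:
  assumes M: "associated m w M" and "even m" "0 < m"
  obtains v where "v \<in> carrier_vec m" "v \<noteq> 0\<^sub>v m" "M *\<^sub>v v = 0\<^sub>v m" "(\<Sum>j<m. v $ j) = 0"
proof -
  obtain k where m: "m = 2 * k"
    using \<open>even m\<close> by blast
  have k: "0 < k"
    using \<open>0 < m\<close> m by simp
  have Mc: "M \<in> carrier_mat m m"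
    and col_sum: "\<And>j. j < m \<Longrightarrow> (\<Sum>i<m. M $$ (i, j)) = real m * w"
    and reflect: "\<And>i j. i < m \<Longrightarrow> j < m \<Longrightarrow> M $$ (i, j) + M $$ (m - 1 - i, m - 1 - j) = 2 * w"
    using M by (auto simp: associated_def semimagic_def)
  define B where "B = mat k k (\<lambda>(i, j). M $$ (i, j) - M $$ (i, m - 1 - j))"
  have Bc: "B \<in> carrier_mat k k"
    by (simp add: B_def)
  have B_col_sum: "(\<Sum>i<k. B $$ (i, j)) = 0" if j: "j < k" for j
  proof -
    have "B $$ (i, j) = M $$ (i, j) + M $$ (2 * k - 1 - i, j) - 2 * w" if "i < k" for i
      using reflect[of i "m - 1 - j"] j that m by (simp add: B_def)
    then have "(\<Sum>i<k. B $$ (i, j)) = (\<Sum>i<k. M $$ (i, j) + M $$ (2 * k - 1 - i, j)) - real k * (2 * w)"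
      by (simp add: sum_subtractf)
    then show ?thesis
      using col_sum[of j] j m sum_reflect_halves[of "\<lambda>i. M $$ (i, j)" k] by simp
  qed
  have "transpose_mat B *\<^sub>v vec k (\<lambda>_. 1) = 0\<^sub>v k"
  proof (rule eq_vecI)
    fix i assume "i < dim_vec (0\<^sub>v k :: real vec)"
    then show "(transpose_mat B *\<^sub>v vec k (\<lambda>_. 1)) $ i = 0\<^sub>v k $ i"
      using B_col_sum[of i] Bc index_mult_mat_vec_sum[of "transpose_mat B" k k "vec k (\<lambda>_. 1)" i]
      by simp
  qed (use Bc in simp)
  moreover have "vec k (\<lambda>_. 1::real) \<noteq> 0\<^sub>v k"
    using k by (metis index_vec index_zero_vec(1) zero_neq_one)
  ultimately have "det (transpose_mat B) = 0"
    using det_0_iff_vec_prod_zero_field[of "transpose_mat B" k] Bc by (metis transpose_carrier_mat vec_carrier)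
  then obtain u where u: "u \<in> carrier_vec k" "u \<noteq> 0\<^sub>v k" "B *\<^sub>v u = 0\<^sub>v k"
    using det_0_iff_vec_prod_zero_field[OF Bc] det_transpose[OF Bc] by auto
  define v where "v = vec m (\<lambda>j. if j < k then u $ j else - u $ (m - 1 - j))"
  have v_low: "v $ j = u $ j" and v_high: "v $ (2 * k - 1 - j) = - u $ j" if "j < k" for j
    using that m by (auto simp: v_def)
  have vc: "v \<in> carrier_vec m"
    by (simp add: v_def)
  have upper: "(\<Sum>j<k. (M $$ (i, j) - M $$ (i, 2 * k - 1 - j)) * u $ j) = 0" if i: "i < k" for i
  proof -
    have "(\<Sum>j<k. (M $$ (i, j) - M $$ (i, 2 * k - 1 - j)) * u $ j) = (B *\<^sub>v u) $ i"
      unfolding index_mult_mat_vec_sum[OF Bc u(1) i]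
      using i m by (intro sum.cong) (auto simp: B_def)
    then show ?thesis
      using u(3) i by simp
  qed
  have Mv: "(M *\<^sub>v v) $ i = (\<Sum>j<k. (M $$ (i, j) - M $$ (i, 2 * k - 1 - j)) * u $ j)" if "i < m" for i
    unfolding index_mult_mat_vec_sum[OF Mc vc that] m sum_reflect_halves
  proof (rule sum.cong[OF refl])
    fix j assume "j \<in> {..<k}"
    then show "M $$ (i, j) * v $ j + M $$ (i, 2 * k - 1 - j) * v $ (2 * k - 1 - j)
        = (M $$ (i, j) - M $$ (i, 2 * k - 1 - j)) * u $ j"
      unfolding lessThan_iff by (simp only: v_low v_high) (simp only: algebra_simps)
  qed
  have "M *\<^sub>v v = 0\<^sub>v m"
  proof (rule eq_vecI)
    fix i assume "i < dim_vec (0\<^sub>v m :: real vec)"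
    then have i: "i < m" by simp
    have "(M *\<^sub>v v) $ i = 0"
    proof (cases "i < k")
      case True
      then show ?thesis using Mv[OF i] upper by simp
    next
      case False
      then have i': "m - 1 - i < k" using i m by linarith
      \<comment> \<open>the image is symmetric, so the lower half repeats the upper one\<close>
      have "M $$ (i, j) - M $$ (i, 2 * k - 1 - j)
          = M $$ (m - 1 - i, j) - M $$ (m - 1 - i, 2 * k - 1 - j)" if "j < k" for j
        using reflect[of i j] reflect[of i "2 * k - 1 - j"] that i m by simp
      then show ?thesis using Mv[OF i] upper[OF i'] by simp
    qed
    then show "(M *\<^sub>v v) $ i = 0\<^sub>v m $ i" using i by simp
  qed (use Mc in simp)
  moreover have "v \<noteq> 0\<^sub>v m"
  proof
    assume "v = 0\<^sub>v m"
    then have "u $ j = 0" if "j < k" for j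
      using v_low[OF that] that m by simp
    then show False using u(1,2) by (auto simp: vec_eq_iff)
  qed
  moreover have "(\<Sum>j<m. v $ j) = 0"
    unfolding m sum_reflect_halves
    by (rule sum.neutral) (metis lessThan_iff v_low v_high right_minus)
  ultimately show ?thesis
    using that vc by blast
qed

lemma U_mat_mult_sum_zero:
  assumes "v \<in> carrier_vec m" "(\<Sum>j<m. v $ j) = 0"
  shows "U_mat m *\<^sub>v v = v"
proof (rule eq_vecI)
  fix i assume "i < dim_vec v"
  then have i: "i < m" using assms(1) by simp
  have "(U_mat m *\<^sub>v v) $ i = (\<Sum>j<m. (if i = j then v $ j else 0) - v $ j / real m)"
    unfolding index_mult_mat_vec_sum[OF U_mat_carrier assms(1) i]
    using i by (intro sum.cong) (auto simp: U_mat_def ones_mat_def algebra_simps)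
  also have "\<dots> = v $ i"
    using assms(2) i by (simp add: sum_subtractf sum_divide_distrib[symmetric])
  finally show "(U_mat m *\<^sub>v v) $ i = v $ i" .
qed (use assms(1) carrier_matD(1)[OF U_mat_carrier] in simp)

lemma associated_even_no_left_quasi_inverse:
  assumes "associated m w M" "even m" "0 < m"
  shows "\<not> left_quasi_inverse m M Q"
proof
  assume "left_quasi_inverse m M Q"
  then have Q: "Q \<in> carrier_mat m m" "Q * M = U_mat m"
    by (auto simp: left_quasi_inverse_def)
  have Mc: "M \<in> carrier_mat m m"
    using assms(1) by (simp add: associated_def semimagic_def)
  obtain v where v: "v \<in> carrier_vec m" "v \<noteq> 0\<^sub>v m" "M *\<^sub>v v = 0\<^sub>v m" "(\<Sum>j<m. v $ j) = 0"
    using associated_even_kernel_sum_zero[OF assms] .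
  have "v = Q * M *\<^sub>v v"
    using U_mat_mult_sum_zero[OF v(1,4)] Q(2) by simp
  also have "\<dots> = Q *\<^sub>v 0\<^sub>v m"
    using assoc_mult_mat_vec[OF Q(1) Mc v(1)] v(3) by simp
  also have "\<dots> = 0\<^sub>v m"
    using Q(1) by auto
  finally show False
    using v(2) by simp
qed

lemma associated_transpose:
  assumes "associated m w M"
  shows "associated m w (transpose_mat M)"
proof -
  have "M \<in> carrier_mat m m"
    using assms by (simp add: associated_def semimagic_def)
  moreover have "m - 1 - i < m" if "i < m" for i
    using that by linarith
  ultimately show ?thesis
    using assms by (auto simp: associated_def semimagic_def)
qed

lemma right_quasi_inverse_transpose:
  assumes "right_quasi_inverse m M Q" "M \<in> carrier_mat m m"
  shows "left_quasi_inverse m (transpose_mat M) (transpose_mat Q)"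
proof -
  have Q: "Q \<in> carrier_mat m m" "M * Q = U_mat m"
    using assms(1) by (auto simp: right_quasi_inverse_def)
  have "transpose_mat Q * transpose_mat M = transpose_mat (U_mat m)"
    using transpose_mult[OF assms(2) Q(1)] Q(2) by simp
  also have "transpose_mat (U_mat m) = U_mat m"
    by (rule eq_matI) (auto simp: U_mat_def ones_mat_def)
  finally show ?thesis
    using Q(1) by (simp add: left_quasi_inverse_def)
qed

lemma associated_even_no_right_quasi_inverse:
  assumes "associated m w M" "even m" "0 < m"
  shows "\<not> right_quasi_inverse m M Q"
  using assms associated_even_no_left_quasi_inverse[OF associated_transpose]
    right_quasi_inverse_transpose semimagic_carrier by (metis associated_def)

lemma associated_even_rank_less:
  assumes "associated m w M" "even m" "0 < m"
  shows "mat_rank m M < m"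
proof -
  have Mc: "M \<in> carrier_mat m m"
    using assms(1) by (simp add: associated_def semimagic_def)
  have "det M = 0"
    using associated_even_kernel_sum_zero[OF assms] det_0_iff_vec_prod_zero_field[OF Mc] by metis
  then show ?thesis
    by (rule vec_space.det_zero_low_rank[OF Mc])
qed

section \<open>Odd dimension\<close>

text \<open>
  The cyclic shift minus its inverse. Reflecting the indices exchanges the two shifts, which is why
  the difference is associated of weight \<open>0\<close>.
\<close>

definition shift_difference :: "nat \<Rightarrow> real mat" where
  "shift_difference m =
     mat m m (\<lambda>(i, j). of_bool (j = Suc i mod m) - of_bool (i = Suc j mod m))"

lemma mod_Suc_eq_iff_pred:
  assumes "i < m" "j < m"
  shows "i = Suc j mod m \<longleftrightarrow> j = (i + (m - 1)) mod m"
  using assms by (cases i) (auto simp: mod_Suc mod_if)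

lemma associated_shift_difference: "associated m 0 (shift_difference m)"
proof -
  let ?N = "shift_difference m"
  have skew: "?N $$ (j, i) = - ?N $$ (i, j)" if "i < m" "j < m" for i j
    using that by (simp add: shift_difference_def)
  have row: "(\<Sum>j<m. ?N $$ (i, j)) = 0" if i: "i < m" for i
  proof -
    have "(\<Sum>j<m. ?N $$ (i, j))
        = (\<Sum>j<m. (if j = Suc i mod m then 1 else 0) - (if j = (i + (m - 1)) mod m then 1 else 0))"
      using i by (intro sum.cong) (auto simp: shift_difference_def mod_Suc_eq_iff_pred)
    then show ?thesis
      using i by (simp add: sum_subtractf)
  qed
  have column: "(\<Sum>i<m. ?N $$ (i, j)) = 0" if j: "j < m" for j
  proof -
    have "(\<Sum>i<m. ?N $$ (i, j)) = (\<Sum>i<m. - ?N $$ (j, i))"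
      by (rule sum.cong[OF refl], rule skew) (use j in simp_all)
    then show ?thesis
      using row[OF j] by (simp add: sum_negf)
  qed
  have swap: "m - 1 - j = Suc (m - 1 - i) mod m \<longleftrightarrow> i = Suc j mod m" if "i < m" "j < m" for i j
    using that by (auto simp: mod_Suc)
  have "?N $$ (i, j) + ?N $$ (m - 1 - i, m - 1 - j) = 0" if "i < m" "j < m" for i j
    using swap[OF that] swap[OF that(2,1)] that by (simp add: shift_difference_def)
  then show ?thesis
    using row column by (auto simp: associated_def semimagic_def shift_difference_def)
qed

text \<open>
  A kernel vector, read with indices modulo \<open>m\<close>, has period \<open>2\<close>. For \<open>m = 2 n + 1\<close> the index \<open>j\<close> is
  congruent to the even number \<open>j (2 n + 2) = j + j m\<close>, so every coordinate equals the \<open>0\<close>-th.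
\<close>

lemma shift_difference_kernel:
  assumes "odd m" and v: "v \<in> carrier_vec m" and ker: "shift_difference m *\<^sub>v v = 0\<^sub>v m"
  shows "\<exists>c. v = vec m (\<lambda>_. c)"
proof -
  obtain n where m: "m = 2 * n + 1"
    using \<open>odd m\<close> by (rule oddE)
  have N: "shift_difference m \<in> carrier_mat m m"
    by (simp add: shift_difference_def)
  define f where "f t = v $ (t mod m)" for t
  have step: "f (t + 2) = f t" for t
  proof -
    define i where "i = Suc t mod m"
    have i: "i < m"
      by (simp add: i_def m)
    have "(shift_difference m *\<^sub>v v) $ i
        = (\<Sum>j<m. (if j = Suc i mod m then v $ j else 0) - (if j = (i + (m - 1)) mod m then v $ j else 0))"
      unfolding index_mult_mat_vec_sum[OF N v i]
      using i by (intro sum.cong) (auto simp: shift_difference_def mod_Suc_eq_iff_pred)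
    also have "\<dots> = v $ (Suc i mod m) - v $ ((i + (m - 1)) mod m)"
      using i by (simp add: sum_subtractf)
    also have "Suc i mod m = (t + 2) mod m"
      by (simp add: i_def mod_Suc_eq)
    also have "(i + (m - 1)) mod m = t mod m"
    proof -
      have "(i + (m - 1)) mod m = (Suc t + (m - 1)) mod m"
        by (simp only: i_def mod_add_left_eq)
      also have "Suc t + (m - 1) = t + m"
        by (simp add: m)
      finally show ?thesis by simp
    qed
    finally show ?thesis
      using ker i by (simp add: f_def)
  qed
  have even_index: "f (2 * l) = f 0" for l
  proof (induction l)
    case (Suc l)
    then show ?case using step[of "2 * l"] by simp
  qed simp
  have "v $ j = f 0" if "j < m" for j
  proof -
    have "2 * (j * (n + 1)) = j + j * m"
      by (simp add: m algebra_simps)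
    then have "f (2 * (j * (n + 1))) = v $ j"
      unfolding f_def using that by (simp only: mod_mult_self1 mod_less)
    then show ?thesis
      using even_index[of "j * (n + 1)"] by simp
  qed
  then show ?thesis
    using v by (intro exI[of _ "f 0"] eq_vecI) auto
qed

lemma rank_shift_difference_add_ones:
  assumes "odd m" "w \<noteq> 0"
  shows "mat_rank m (shift_difference m + w \<cdot>\<^sub>m ones_mat m) = m"
proof (rule vec_space.low_rank_det_zero)
  have N: "semimagic m 0 (shift_difference m)"
    using associated_shift_difference by (simp add: associated_def)
  show "shift_difference m + w \<cdot>\<^sub>m ones_mat m \<in> carrier_mat m m"
    by simp
  show "det (shift_difference m + w \<cdot>\<^sub>m ones_mat m) \<noteq> 0"
    using det_add_ones_nonzero[OF N assms(2) shift_difference_kernel[OF assms(1)]] .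
qed

lemma rank_shift_difference:
  assumes "odd m"
  shows "mat_rank m (shift_difference m) = m - 1"
proof -
  have N: "semimagic m 0 (shift_difference m)"
    using associated_shift_difference by (simp add: associated_def)
  have "m = mat_rank m (shift_difference m + ones_mat m)"
    using rank_shift_difference_add_ones[OF assms, of 1] by (simp add: one_smult_ones_mat)
  also have "\<dots> \<le> mat_rank m (shift_difference m) + mat_rank m (ones_mat m)"
    by (rule vec_space.rank_subadditive[OF semimagic_carrier[OF N] ones_mat_carrier])
  finally show ?thesis
    using rank_ones_mat_le_1[of m] semimagic_zero_rank_less[OF N odd_pos[OF assms]] by linarith
qed

theorem theorem8:
  shows
    "(\<forall>m w M. even m \<and> m > 0 \<and> associated m w M \<longrightarrow>
        mat_rank m M \<noteq> m \<and>
        \<not> (\<exists>Q. left_quasi_inverse m M Q) \<and>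
        \<not> (\<exists>Q. right_quasi_inverse m M Q))
   \<and> (\<forall>n.
        (\<exists>w M. w \<noteq> 0 \<and> associated (2 * n + 1) w M \<and> mat_rank (2 * n + 1) M = 2 * n + 1) \<and>
        ((\<exists>M. associated (2 * n + 1) 0 M \<and> mat_rank (2 * n + 1) M = 2 * n) \<and>
         (\<forall>M. associated (2 * n + 1) 0 M \<longrightarrow> mat_rank (2 * n + 1) M \<le> 2 * n)) \<and>
        (\<forall>M. associated (2 * n + 1) 0 M \<and> mat_rank (2 * n + 1) M = 2 * n \<longrightarrow>
          (\<exists>Q. left_quasi_inverse (2 * n + 1) M Q) \<and>
          (\<exists>Q. right_quasi_inverse (2 * n + 1) M Q)))"
proof -
  have even_dim: "mat_rank m M \<noteq> m \<and> \<not> (\<exists>Q. left_quasi_inverse m M Q) \<and> \<not> (\<exists>Q. right_quasi_inverse m M Q)"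
    if "even m \<and> m > 0 \<and> associated m w M" for m w M
    using that associated_even_rank_less[of m w M, THEN less_imp_neq] associated_even_no_left_quasi_inverse
      associated_even_no_right_quasi_inverse by blast
  have full_rank: "\<exists>w M. w \<noteq> 0 \<and> associated (2 * n + 1) w M \<and> mat_rank (2 * n + 1) M = 2 * n + 1" for n
    using associated_add_ones[OF associated_shift_difference, of "2 * n + 1" 1]
      rank_shift_difference_add_ones[of "2 * n + 1" 1]
    by (intro exI[of _ 1] exI[of _ "shift_difference (2 * n + 1) + 1 \<cdot>\<^sub>m ones_mat (2 * n + 1)"]) simp
  have max_rank_attained: "\<exists>M. associated (2 * n + 1) 0 M \<and> mat_rank (2 * n + 1) M = 2 * n" for n
    using associated_shift_difference[of "2 * n + 1"] rank_shift_difference[of "2 * n + 1"] by auto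
  have max_rank: "mat_rank (2 * n + 1) M \<le> 2 * n" if "associated (2 * n + 1) 0 M" for n M
    using semimagic_zero_rank_less[of "2 * n + 1" M] that by (simp add: associated_def)
  have quasi_inverses: "(\<exists>Q. left_quasi_inverse (2 * n + 1) M Q) \<and> (\<exists>Q. right_quasi_inverse (2 * n + 1) M Q)"
    if "associated (2 * n + 1) 0 M \<and> mat_rank (2 * n + 1) M = 2 * n" for n M
    using semimagic_quasi_inverses[of "2 * n + 1" M] that by (simp add: associated_def)
  show ?thesis
    by (intro conjI allI; (rule full_rank max_rank_attained |
        (rule impI, erule even_dim max_rank quasi_inverses)))
qed

end
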